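(* Let $q=p^k$ for some odd prime $p$ and some integer $k>0$. Let $Q,R,S$ be integers each of the form $p^i$ for some integer $i\ge 0$ (the exponents may differ). Let $r>0$ be an integer with $r\equiv Q+R+S\pmod{q+1}$. Let $f(X):=X^rB(X^{q-1})$, where one of the following holds: (1) $B(X):=X^{Q+R}-X^{Q+S}-X^{R+S}-1$ and $(Q,R,S)\equiv\pm(1,1,1)\pmod 4$; (2) $B(X):=X^{R+S}-X^{Q+R}-X^{Q+S}-1$ and $(Q,R,S)\equiv\pm(1,-1,1)\pmod 4$; (3) $B(X):=X^{Q+R}+X^{Q+S}+X^{R+S}-1$ and $(Q,R,S)\equiv\pm(1,1,-1)\pmod 4$. Then $f(X)$ permutes $\mathbb{F}_{q^2}$ if and only if $q\equiv 1\pmod 4$ and $\gcd(r,q-1)=1$ and $\gcd(Q+R-S,q+1)=1$.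
   Context: A polynomial $f(X)\in\mathbb{F}_{q^2}[X]$ permutes $\mathbb{F}_{q^2}$ if the map $\alpha\mapsto f(\alpha)$ is a bijection of $\mathbb{F}_{q^2}$. For integers $\epsilon_1,\epsilon_2,\epsilon_3$, the notation $(Q,R,S)\equiv\pm(\epsilon_1,\epsilon_2,\epsilon_3)\pmod 4$ means that there is a single sign $s\in\{1,-1\}$ with $Q\equiv s\epsilon_1$, $R\equiv s\epsilon_2$, $S\equiv s\epsilon_3\pmod 4$. *)

theory Defs
  imports "HOL-Number_Theory.Number_Theory" "HOL-Computational_Algebra.Polynomial"
begin

definition permutes_field :: "'a::{field,finite} poly \<Rightarrow> bool" where
  "permutes_field f \<longleftrightarrow> bij (poly f)"

text \<open>\<open>(Q, R, S) \<equiv> \<plusminus>(e1, e2, e3) (mod 4)\<close>, with a single sign common to all three entries.\<close>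

definition cong_pm_mod4 :: "int \<times> int \<times> int \<Rightarrow> int \<times> int \<times> int \<Rightarrow> bool" where
  "cong_pm_mod4 = (\<lambda>(Q, R, S) (e1, e2, e3). \<exists>s\<in>{1, -1}.
     [Q = s * e1] (mod 4) \<and> [R = s * e2] (mod 4) \<and> [S = s * e3] (mod 4))"

end

theory Submission
  imports Defs
begin

text \<open>
  Since \<open>x \<mapsto> x ^ (q - 1)\<close> maps the nonzero elements onto the \<open>(q + 1)\<close>-th roots of unity \<open>\<mu>\<close>
  and raising \<open>f\<close> to the power \<open>q - 1\<close> turns it into \<open>g y = y ^ r * B y ^ (q - 1)\<close>, the polynomial
  \<open>f\<close> permutes the field iff \<open>r\<close> is coprime to \<open>q - 1\<close> and \<open>g\<close> permutes \<open>\<mu>\<close>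
  (\<open>bij_power_times_iff\<close>).

  On \<open>\<mu>\<close> the \<open>q\<close>-th power is inversion, so \<open>g y = y ^ (Q + R + S) * B (1 / y) / B y\<close>. In the three
  cases this quotient is, up to signs, the addition formula expressing
  \<open>tan (\<alpha> \<plusminus> \<beta> \<plusminus> \<gamma>)\<close> by the tangents \<open>y ^ Q\<close>, \<open>y ^ R\<close> and \<open>y ^ S\<close>. As with tangents over the
  complex numbers, the transform \<open>y \<mapsto> (1 + \<iota> * y) / (1 - \<iota> * y)\<close> with \<open>\<iota> * \<iota> = -1\<close> makes addition
  of angles multiplicative. Moreover \<open>1 + \<iota> * y ^ Q\<close> is \<open>(1 \<plusminus> \<iota> * y) ^ Q\<close>, where the sign is given
  by \<open>Q\<close> modulo 4. The congruence conditions are such that these signs combine, in each of the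
  three cases, to the exponent \<open>Q + R - S\<close> up to a common sign; precisely, \<open>-2 * B\<close> is the sum of
  \<open>(1 + \<iota> * y) ^ (Q + R) * (1 - \<iota> * y) ^ S\<close> and the same expression with \<open>-\<iota>\<close> in place of \<open>\<iota>\<close>
  (\<open>quadrinomial_eq_symmetric_split\<close>).

  If \<open>q \<equiv> 1\<close> modulo 4, then \<open>\<iota>\<close> lies in the subfield of order \<open>q\<close>, and the transform maps \<open>\<mu>\<close>
  bijectively to the coset \<open>{z. z ^ (q + 1) = -1}\<close> of \<open>\<mu>\<close> (\<open>bij_betw_cayley\<close>). Up to
  injective fractional linear maps on both sides, \<open>g\<close> is then the power map with exponent \<open>Q + R - S\<close>
  on this coset, which is injective iff \<open>Q + R - S\<close> is coprime to \<open>q + 1\<close>. If \<open>q \<equiv> 3\<close> modulo 4, then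
  \<open>\<iota>\<close> itself lies in \<open>\<mu>\<close> and is a zero of \<open>B\<close>, so \<open>g\<close> does not map \<open>\<mu>\<close> to itself.
\<close>

section \<open>Roots of unity in finite fields\<close>

abbreviation unity_roots :: "nat \<Rightarrow> 'a::monoid_mult set" where
  "unity_roots m \<equiv> {x. x ^ m = 1}"

lemma card_minus_1_pos: "card (UNIV :: 'a::{field,finite} set) - 1 > 0"
proof -
  have "(1 :: 'a) \<in> UNIV - {0}" by simp
  then have "card (UNIV - {0 :: 'a}) > 0" using card_gt_0_iff finite by blast
  then show ?thesis by simp
qed

text \<open>Multiplication by \<open>x\<close> permutes the nonzero elements, hence fixes their product.\<close>
lemma power_card_minus_1:
  fixes x :: "'a::{field,finite}"
  assumes "x \<noteq> 0"
  shows "x ^ (card (UNIV :: 'a set) - 1) = 1"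
proof -
  let ?P = "\<Prod>(UNIV - {0 :: 'a})"
  have "bij_betw ((*) x) (UNIV - {0}) (UNIV - {0})"
    using assms by (intro bij_betw_byWitness[where f' = "\<lambda>y. y / x"]) auto
  then have "?P = (\<Prod>y\<in>UNIV - {0}. x * y)"
    by (rule prod.reindex_bij_betw[symmetric])
  also have "\<dots> = x ^ (card (UNIV :: 'a set) - 1) * ?P"
    by (simp add: prod.distrib)
  finally show ?thesis by simp
qed

lemma card_power_fibre_le:
  fixes c :: "'a::idom"
  assumes "d > 0"
  shows "finite {x. x ^ d = c}" "card {x. x ^ d = c} \<le> d"
proof -
  let ?p = "monom 1 d - [:c:]"
  have "coeff ?p d = 1" using assms by (cases d) auto
  then have nz: "?p \<noteq> 0" by (metis coeff_0 zero_neq_one)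
  have eq: "{x. poly ?p x = 0} = {x. x ^ d = c}" by (simp add: poly_monom)
  show "finite {x. x ^ d = c}" using poly_roots_finite[OF nz] eq by simp
  have "degree ?p \<le> d"
    by (intro degree_diff_le) (auto simp: degree_monom_eq)
  then show "card {x. x ^ d = c} \<le> d"
    using card_poly_roots_bound[OF nz] eq by simp
qed

text \<open>
  Both facts come out of one count: the \<open>d * m\<close> nonzero elements fall into fibres of at most \<open>d\<close>
  elements under the \<open>d\<close>-th power, so there are at least \<open>m\<close> values, while all values are among the
  at most \<open>m\<close> zeros of \<open>X ^ m - 1\<close>. This gives as much of the cyclicity of the multiplicative
  group as the proof requires.
\<close>
lemma unity_roots_finite_field:
  fixes d m :: nat
  assumes dm: "card (UNIV :: 'a::{field,finite} set) - 1 = d * m"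
  shows power_image_eq_unity_roots: "(\<lambda>x :: 'a. x ^ d) ` (UNIV - {0}) = unity_roots m"
    and card_unity_roots: "card (unity_roots m :: 'a set) = m"
proof -
  let ?A = "UNIV - {0 :: 'a}" and ?I = "(\<lambda>x :: 'a. x ^ d) ` (UNIV - {0})"
  have cA: "card ?A = d * m" using dm by simp
  have "0 < d * m" using card_minus_1_pos[where ?'a = 'a] unfolding dm .
  then have pos: "d > 0" "m > 0" by auto
  have sub: "?I \<subseteq> unity_roots m"
    using power_card_minus_1[where ?'a = 'a] dm by (auto simp flip: power_mult)
  have "?A \<subseteq> (\<Union>y\<in>?I. {x. x ^ d = y})" by auto
  then have "d * m \<le> card (\<Union>y\<in>?I. {x :: 'a. x ^ d = y})"
    using cA card_mono[OF finite] by metis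
  also have "\<dots> \<le> (\<Sum>y\<in>?I. card {x :: 'a. x ^ d = y})"
    by (rule card_UN_le) simp
  also have "\<dots> \<le> card ?I * d"
    using sum_bounded_above[of ?I "\<lambda>y. card {x :: 'a. x ^ d = y}" d,
        OF card_power_fibre_le(2)[OF pos(1)]] by simp
  finally have lower: "m \<le> card ?I" using pos(1) by (simp add: mult.commute)
  have upper: "card (unity_roots m :: 'a set) \<le> m" by (rule card_power_fibre_le(2)[OF pos(2)])
  show img: "?I = unity_roots m"
    by (rule card_seteq) (use sub lower upper in auto)
  show "card (unity_roots m :: 'a set) = m"
    using lower upper unfolding img by simp
qed

lemma power_int_eq_1_coprime:
  fixes x :: "'a::field"
  assumes "x \<noteq> 0" "x powi m = 1" "x powi n = 1" "coprime m n"
  shows "x = 1"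
proof -
  obtain u v where uv: "u * m + v * n = 1"
    using bezout_int[of m n] assms(4) by auto
  have "x = x powi (m * u + n * v)" using uv by (simp add: mult.commute)
  also have "\<dots> = 1"
    using assms by (simp add: power_int_add power_int_mult)
  finally show ?thesis .
qed

text \<open>
  The set \<open>{z. z ^ m = c}\<close> is a coset of the group of \<open>m\<close>-th roots of unity, and two of its elements
  have the same \<open>n\<close>-th power iff their quotient is a root of unity of order dividing both \<open>n\<close>
  and \<open>m\<close>. If \<open>gcd n m > 1\<close>, a nontrivial such root exists because all \<open>m\<close>-th roots of unity lie in
  the field.
\<close>
lemma inj_on_power_int_coset_iff:
  fixes z0 c :: "'a::{field,finite}" and n :: int
  assumes m: "m dvd card (UNIV :: 'a set) - 1"
    and z0: "z0 ^ m = c" and c: "c \<noteq> 0"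
  shows "inj_on (\<lambda>z. z powi n) {z. z ^ m = c} \<longleftrightarrow> coprime n (int m)"
proof -
  have m0: "m > 0" using m card_minus_1_pos[where ?'a = 'a] by (auto intro: Nat.gr0I)
  show ?thesis
  proof
    have z0_nz: "z0 \<noteq> 0" using z0 c m0 by auto
    assume inj: "inj_on (\<lambda>z. z powi n) {z. z ^ m = c}"
    define d where "d = nat (gcd n (int m))"
    have dn: "int d dvd n" and "int d dvd int m" by (auto simp: d_def)
    then have dm: "d dvd m" by simp
    have "w = 1" if w: "w ^ d = 1" for w :: 'a
    proof -
      have "w ^ m = 1" using dm w by (auto simp: dvd_def power_mult)
      moreover have "w powi n = 1"
        using dn w by (auto simp: dvd_def power_int_mult)
      ultimately have "(w * z0) powi n = z0 powi n" "(w * z0) ^ m = c"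
        using z0 by (simp_all add: power_int_mult_distrib power_mult_distrib)
      then have "w * z0 = z0" by - (rule inj_onD[OF inj], use z0 in auto)
      then show "w = 1" using z0_nz by simp
    qed
    then have "unity_roots d = {1 :: 'a}" by auto
    moreover obtain e where "card (UNIV :: 'a set) - 1 = e * d"
      using dvd_trans[OF dm m] by (metis dvd_def mult.commute)
    ultimately have "d = 1" using card_unity_roots[of e d, where ?'a = 'a] by simp
    then have "gcd n (int m) = 1" unfolding d_def by simp
    then show "coprime n (int m)" by (simp only: coprime_iff_gcd_eq_1)
  next
    assume cop: "coprime n (int m)"
    show "inj_on (\<lambda>z. z powi n) {z. z ^ m = c}"
    proof (rule inj_onI, simp)
      fix x y assume xy: "x ^ m = c" "y ^ m = c" "x powi n = y powi n"
      then have nz: "x \<noteq> 0" "y \<noteq> 0" using c m0 zero_power by metis+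
      have "x / y = 1"
        by (rule power_int_eq_1_coprime[OF _ _ _ cop])
          (use xy nz c in \<open>auto simp: power_int_divide_distrib power_divide\<close>)
      then show "x = y" using nz by simp
    qed
  qed
qed

section \<open>Permutations by functions in a power of the variable\<close>

text \<open>
  The criterion rests on \<open>f x ^ s = g (x ^ s)\<close>, where \<open>f\<close> and \<open>g\<close> are the two functions below: \<open>g\<close>
  describes how \<open>f\<close> acts on the cosets of the group of \<open>s\<close>-th roots of unity, and on each
  coset \<open>f\<close> is a multiple of the \<open>r\<close>-th power, which is injective there iff \<open>r\<close> is coprime to \<open>s\<close>.
  A zero of \<open>h\<close> on the \<open>m\<close>-th roots of unity violates both sides: it gives \<open>f\<close> a second zero and \<open>g\<close>
  the value 0, which is not a root of unity.
\<close>
theorem bij_power_times_iff: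
  fixes h :: "'a::{field,finite} \<Rightarrow> 'a"
  assumes sm: "card (UNIV :: 'a set) - 1 = s * m" and r: "r > 0"
  shows "bij (\<lambda>x. x ^ r * h (x ^ s)) \<longleftrightarrow>
    coprime r s \<and> bij_betw (\<lambda>y. y ^ r * h y ^ s) (unity_roots m) (unity_roots m)"
    (is "bij ?f \<longleftrightarrow> _ \<and> bij_betw ?g ?M ?M")
proof
  have img: "(\<lambda>x. x ^ s) ` (UNIV - {0}) = ?M" by (rule power_image_eq_unity_roots[OF sm])
  have root: "\<exists>x. x \<noteq> 0 \<and> x ^ s = y" if "y \<in> ?M" for y
    using that unfolding img[symmetric] by auto
  have unity: "x ^ s \<in> ?M" if "x \<noteq> 0" for x
    using that unfolding img[symmetric] by auto
  have fg: "?f x ^ s = ?g (x ^ s)" for x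
    by (simp add: power_mult_distrib mult.commute flip: power_mult)
  have f0: "?f 0 = 0" using r by simp
  {
    assume f: "bij ?f"
    then have inj: "inj ?f" by (rule bij_is_inj)
    have "w = 1" if w: "w ^ gcd r s = 1" for w :: 'a
    proof (rule injD[OF inj])
      have "w ^ r = 1" "w ^ s = 1"
        using w by (metis dvdE gcd_dvd1 power_mult power_one, metis dvdE gcd_dvd2 power_mult power_one)
      then show "?f w = ?f 1" by simp
    qed
    then have "unity_roots (gcd r s) = {1 :: 'a}" by auto
    moreover obtain e where "s * m = e * gcd r s"
      by (metis dvd_def dvd_mult2 gcd_dvd2 mult.commute)
    ultimately have "gcd r s = 1"
      using card_unity_roots[of e "gcd r s", where ?'a = 'a] sm by simp
    then have cop: "coprime r s" by (simp only: coprime_iff_gcd_eq_1)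
    have into: "?g ` ?M \<subseteq> ?M"
    proof
      fix z assume "z \<in> ?g ` ?M"
      then obtain y where y: "z = ?g y" "y \<in> ?M" by (rule imageE)
      obtain x where "x \<noteq> 0" "x ^ s = y" using root[OF y(2)] by (elim exE conjE)
      then have x: "x \<noteq> 0" "z = ?g (x ^ s)" using y(1) by simp_all
      have "?f x \<noteq> 0" using injD[OF inj, of x 0] f0 x(1) by metis
      then show "z \<in> ?M" unfolding x(2) fg[symmetric] by (rule unity)
    qed
    have onto: "?M \<subseteq> ?g ` ?M"
    proof
      fix z assume "z \<in> ?M"
      then obtain w where w: "w \<noteq> 0" "z = w ^ s" using root by metis
      obtain x where x: "w = ?f x" using surjD[OF bij_is_surj[OF f], of w] by (rule exE)
      have "x \<noteq> 0"
      proof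
        assume "x = 0"
        then have "?f x = 0" using f0 by simp
        with x w(1) show False by metis
      qed
      moreover have "z = ?g (x ^ s)" unfolding w(2) x by (rule fg)
      ultimately show "z \<in> ?g ` ?M" using unity by blast
    qed
    have "bij_betw ?g ?M ?M"
      using finite_surj_inj[OF _ onto] into onto by (auto simp: bij_betw_def)
    with cop show "coprime r s \<and> bij_betw ?g ?M ?M" ..
  next
    assume "coprime r s \<and> bij_betw ?g ?M ?M"
    then have cop: "coprime r s" and inj_g: "inj_on ?g ?M" and g: "?g ` ?M = ?M"
      by (auto simp: bij_betw_def)
    have f_nz: "?f x \<noteq> 0" if "x \<noteq> 0" for x
    proof -
      have "?f x ^ s \<in> ?M" unfolding fg using imageI[OF unity[OF that], of ?g] g by simp
      moreover have "(0 :: 'a) \<notin> ?M" using root by (metis power_not_zero)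
      moreover have "s > 0"
        using sm card_minus_1_pos[where ?'a = 'a] by (auto intro: Nat.gr0I)
      ultimately show ?thesis by (metis zero_power)
    qed
    have "inj ?f"
    proof (rule injI)
      fix x x' assume eq: "?f x = ?f x'"
      show "x = x'"
      proof (cases "x = 0 \<or> x' = 0")
        case True
        then show ?thesis using f_nz[of x] f_nz[of x'] f0 eq by metis
      next
        case False
        then have nz: "x \<noteq> 0" "x' \<noteq> 0" by auto
        have s_eq: "x ^ s = x' ^ s"
        proof (rule inj_onD[OF inj_g])
          show "?g (x ^ s) = ?g (x' ^ s)" using eq fg by metis
          show "x ^ s \<in> ?M" "x' ^ s \<in> ?M" using nz unity by blast+
        qed
        moreover have "h (x ^ s) \<noteq> 0" using f_nz[OF nz(1)] by auto
        ultimately have "x ^ r = x' ^ r" using eq by auto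
        then have "x / x' = 1"
          by - (rule power_int_eq_1_coprime[where m = "int r" and n = "int s"],
            use nz s_eq cop in \<open>auto simp: power_divide\<close>)
        then show ?thesis using nz by simp
      qed
    qed
    then show "bij ?f" using finite_UNIV_inj_surj[OF finite] by (auto simp: bij_def)
  }
qed

section \<open>The Cayley transform\<close>

definition cayley :: "'a::field \<Rightarrow> 'a \<Rightarrow> 'a" where
  "cayley \<iota> y = (1 + \<iota> * y) / (1 - \<iota> * y)"

text \<open>
  The transform has neither a pole nor a zero at the root of unity \<open>y\<close>: \<open>(\<iota> * y) ^ (q + 1)\<close> is \<open>-1\<close>,
  whereas \<open>1\<close> and \<open>-1\<close> have \<open>(q + 1)\<close>-th power 1.
\<close>
lemma cayley_denominators_nonzero:
  fixes \<iota> y :: "'a::field"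
  assumes "(2 :: 'a) \<noteq> 0" "odd q" "\<iota> ^ (q + 1) = -1" "y ^ (q + 1) = 1"
  shows "1 + \<iota> * y \<noteq> 0" "1 - \<iota> * y \<noteq> 0"
proof -
  have "(\<iota> * y) ^ (q + 1) = -1" using assms(3,4) by (simp only: power_mult_distrib mult_1_right)
  moreover have "(-1 :: 'a) ^ (q + 1) = 1" "(1 :: 'a) ^ (q + 1) = 1"
    using assms(2) by auto
  moreover have "(1 :: 'a) \<noteq> -1" using assms(1) by (simp add: eq_neg_iff_add_eq_0)
  ultimately have "\<iota> * y \<noteq> -1" "\<iota> * y \<noteq> 1" by metis+
  then show "1 + \<iota> * y \<noteq> 0" "1 - \<iota> * y \<noteq> 0"
    by (auto simp: add_eq_0_iff)
qed

text \<open>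
  For \<open>y ^ (q + 1) = 1\<close> the \<open>q\<close>-th power sends \<open>y\<close> to \<open>1 / y\<close> and fixes \<open>\<iota>\<close>, hence sends
  \<open>z = cayley \<iota> y\<close> to \<open>(y + \<iota>) / (y - \<iota>)\<close>. Since \<open>y + \<iota> = \<iota> * (1 - \<iota> * y)\<close> and
  \<open>y - \<iota> = - \<iota> * (1 + \<iota> * y)\<close>, this is \<open>-1 / z\<close>. The same computation applies to the inverse
  \<open>z \<mapsto> (z - 1) / (\<iota> * (z + 1))\<close>.
\<close>
lemma bij_betw_cayley:
  fixes \<iota> :: "'a::field"
  assumes two: "(2 :: 'a) \<noteq> 0" and q: "odd q" and i2: "\<iota> * \<iota> = -1" and iq: "\<iota> ^ q = \<iota>"
    and frob: "\<And>x y :: 'a. (x + y) ^ q = x ^ q + y ^ q"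
  shows "bij_betw (cayley \<iota>) (unity_roots (q + 1)) {z. z ^ (q + 1) = -1}"
proof (rule bij_betw_byWitness[where f' = "\<lambda>z. (z - 1) / (\<iota> * (z + 1))"])
  have i_nz: "\<iota> \<noteq> 0" using i2 by auto
  have iq1: "\<iota> ^ (q + 1) = -1" using iq i2 by simp
  have neg: "(-x) ^ q = - (x ^ q)" for x :: 'a using q by simp
  have diff: "(x - y) ^ q = x ^ q - y ^ q" for x y :: 'a
    using frob[of x "-y"] neg by simp
  have ne: "(1 :: 'a) \<noteq> -1" using two by (simp add: eq_neg_iff_add_eq_0)
  note nz = cayley_denominators_nonzero[OF two q iq1]
  have z_ne: "z + 1 \<noteq> 0" "z - 1 \<noteq> 0" if "z ^ (q + 1) = -1" for z :: 'a
  proof -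
    have "(-1 :: 'a) ^ (q + 1) = 1" "(1 :: 'a) ^ (q + 1) = 1" using q by auto
    then have "z \<noteq> -1" "z \<noteq> 1" using that ne by metis+
    then show "z + 1 \<noteq> 0" "z - 1 \<noteq> 0" by (auto simp: add_eq_0_iff2)
  qed
  show "\<forall>y\<in>unity_roots (q + 1). (cayley \<iota> y - 1) / (\<iota> * (cayley \<iota> y + 1)) = y"
  proof
    fix y :: 'a assume "y \<in> unity_roots (q + 1)"
    then have y: "y ^ (q + 1) = 1" by simp
    have "cayley \<iota> y - 1 = 2 * \<iota> * y / (1 - \<iota> * y)" "cayley \<iota> y + 1 = 2 / (1 - \<iota> * y)"
      using nz[OF y] by (auto simp: cayley_def field_simps)
    then show "(cayley \<iota> y - 1) / (\<iota> * (cayley \<iota> y + 1)) = y"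
      using nz[OF y] two i_nz by simp
  qed
  show "\<forall>z\<in>{z. z ^ (q + 1) = -1}. cayley \<iota> ((z - 1) / (\<iota> * (z + 1))) = z"
  proof
    fix z :: 'a assume "z \<in> {z. z ^ (q + 1) = -1}"
    then have "z + 1 \<noteq> 0" using z_ne by simp
    moreover have "\<iota> * ((z - 1) / (\<iota> * (z + 1))) = (z - 1) / (z + 1)"
      using i_nz by simp
    ultimately have "1 + \<iota> * ((z - 1) / (\<iota> * (z + 1))) = 2 * z / (z + 1)"
      "1 - \<iota> * ((z - 1) / (\<iota> * (z + 1))) = 2 / (z + 1)"
      by (simp_all add: field_simps)
    then show "cayley \<iota> ((z - 1) / (\<iota> * (z + 1))) = z"
      using \<open>z + 1 \<noteq> 0\<close> two by (simp add: cayley_def)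
  qed
  show "cayley \<iota> ` unity_roots (q + 1) \<subseteq> {z. z ^ (q + 1) = -1}"
  proof (safe)
    fix y :: 'a assume y: "y ^ (q + 1) = 1"
    have "(1 + \<iota> * y) ^ q * y = y + \<iota>" "(1 - \<iota> * y) ^ q * y = y - \<iota>"
      using y iq by (auto simp: frob diff power_mult_distrib algebra_simps)
    moreover have "y + \<iota> = \<iota> * (1 - \<iota> * y)" "y - \<iota> = - \<iota> * (1 + \<iota> * y)"
      using i2 by (auto simp: algebra_simps simp flip: mult.assoc)
    ultimately have e: "(1 + \<iota> * y) ^ q * y = \<iota> * (1 - \<iota> * y)"
      "(1 - \<iota> * y) ^ q * y = - (\<iota> * (1 + \<iota> * y))" by simp_all
    have "(1 + \<iota> * y) ^ (q + 1) * y = (1 + \<iota> * y) * (\<iota> * (1 - \<iota> * y))"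
      "(1 - \<iota> * y) ^ (q + 1) * y = - ((1 - \<iota> * y) * (\<iota> * (1 + \<iota> * y)))"
      by (simp_all add: mult.assoc e)
    then have "(1 + \<iota> * y) ^ (q + 1) * y = - ((1 - \<iota> * y) ^ (q + 1)) * y"
      by (simp only: mult_ac mult_minus_left mult_minus_right minus_minus)
    moreover have "y \<noteq> 0" using y by auto
    ultimately have "(1 + \<iota> * y) ^ (q + 1) = - ((1 - \<iota> * y) ^ (q + 1))" by (metis mult_cancel_right)
    then show "cayley \<iota> y ^ (q + 1) = -1"
      using nz(2)[OF y] by (simp only: cayley_def power_divide) simp
  qed
  show "(\<lambda>z. (z - 1) / (\<iota> * (z + 1))) ` {z. z ^ (q + 1) = -1} \<subseteq> unity_roots (q + 1)"
  proof (safe)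
    fix z :: 'a assume z: "z ^ (q + 1) = -1"
    have zz: "z ^ q * z = -1" using z by (simp add: mult.commute)
    have e: "(z - 1) ^ q * z = - (z + 1)" "(z + 1) ^ q * z = z - 1"
      using zz by (auto simp: frob diff algebra_simps)
    have "(z - 1) ^ (q + 1) * z = (z - 1) * - (z + 1)"
      "(z + 1) ^ (q + 1) * z = (z + 1) * (z - 1)"
      by (simp_all only: Suc_eq_plus1[symmetric] power_Suc mult.assoc e)
    then have "(z - 1) ^ (q + 1) * z = - ((z + 1) ^ (q + 1)) * z"
      by (simp only: mult_ac mult_minus_left mult_minus_right minus_minus)
    moreover have "z \<noteq> 0" using z by auto
    ultimately have "(z - 1) ^ (q + 1) = - ((z + 1) ^ (q + 1))" by (metis mult_cancel_right)
    then show "((z - 1) / (\<iota> * (z + 1))) ^ (q + 1) = 1"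
      using z_ne[OF z] iq1 by (simp only: power_divide power_mult_distrib) simp
  qed
qed

section \<open>The quadrinomials\<close>

lemma power_imaginary_unit:
  fixes \<iota> :: "'a::comm_ring_1"
  assumes "\<iota> * \<iota> = -1" "t \<in> {1, -1}" "[int Q = t] (mod 4)"
  shows "\<iota> ^ Q = of_int t * \<iota>"
proof -
  have i4: "\<iota> ^ (4 * n) = 1" for n
    using assms(1) by (simp add: power_mult power4_eq_xxxx mult.assoc)
  from assms(2) show ?thesis
  proof
    assume t: "t = 1"
    then have "Q mod 4 = 1" using assms(3) by (simp add: cong_def) presburger
    then obtain n where "Q = 4 * n + 1" by (metis mult_div_mod_eq)
    then show ?thesis using i4[of n] t by (simp add: power_add)
  next
    assume "t \<in> {-1}"
    then have t: "t = -1" by simp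
    then have "Q mod 4 = 3" using assms(3) by (simp add: cong_def) presburger
    then obtain n where "Q = 4 * n + 3" by (metis mult_div_mod_eq)
    then show ?thesis using i4[of n] t assms(1) by (simp add: power_add power3_eq_cube mult.assoc)
  qed
qed

text \<open>
  This is where the residues modulo 4 enter: the \<open>Q\<close>-th power is a ring homomorphism sending \<open>\<iota>\<close>
  to \<open>\<iota>\<close> or to \<open>-\<iota>\<close>.
\<close>
lemma power_one_plus_imaginary:
  fixes \<iota> x :: "'a::comm_ring_1"
  assumes "\<iota> * \<iota> = -1" "t \<in> {1, -1}" "[int Q = t] (mod 4)"
    and frob: "\<And>x y :: 'a. (x + y) ^ Q = x ^ Q + y ^ Q"
  shows "(1 + \<iota> * x) ^ Q = 1 + of_int t * \<iota> * x ^ Q"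
    and "(1 - \<iota> * x) ^ Q = 1 - of_int t * \<iota> * x ^ Q"
proof -
  have "odd Q"
  proof -
    have "odd (int Q)" using assms(2,3) by (auto simp: cong_def) presburger+
    then show ?thesis by simp
  qed
  then show "(1 + \<iota> * x) ^ Q = 1 + of_int t * \<iota> * x ^ Q"
    "(1 - \<iota> * x) ^ Q = 1 - of_int t * \<iota> * x ^ Q"
    using frob[of 1 "\<iota> * x"] frob[of 1 "- (\<iota> * x)"] power_imaginary_unit[OF assms(1-3)]
    by (auto simp: power_mult_distrib)
qed

text \<open>
  With tangents \<open>x\<close> in mind, this is a multiple of the cosine of \<open>A - S\<close> times the angle: the sum
  of the two conjugate values of \<open>exp (i * (A - S) * angle)\<close>, cleared of denominators.
\<close>
definition symmetric_split :: "nat \<Rightarrow> nat \<Rightarrow> 'a::comm_ring_1 \<Rightarrow> 'a \<Rightarrow> 'a" where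
  "symmetric_split A S \<iota> x =
     (1 + \<iota> * x) ^ A * (1 - \<iota> * x) ^ S + (1 - \<iota> * x) ^ A * (1 + \<iota> * x) ^ S"

text \<open>
  Writing \<open>e1\<close>, \<open>e2\<close>, \<open>e3\<close> for the residues \<open>\<plusminus>1\<close> of \<open>Q\<close>, \<open>R\<close>, \<open>S\<close> modulo 4 and \<open>a\<close>, \<open>b\<close>, \<open>c\<close> for the
  corresponding powers of \<open>x\<close>, the first summand on the right is
  \<open>(1 + e1 * \<iota> * a) * (1 + e2 * \<iota> * b) * (1 - e3 * \<iota> * c)\<close>, and adding the summand with \<open>-\<iota>\<close> leaves
  \<open>2 * (1 - e1 * e2 * a * b + e1 * e3 * a * c + e2 * e3 * b * c)\<close>. The signs depend only on products
  of two residues, hence not on the common sign of the three.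
\<close>
lemma quadrinomial_eq_symmetric_split:
  fixes \<iota> x :: "'a::field" and B :: "'a poly"
  assumes i2: "\<iota> * \<iota> = -1"
    and frob: "\<And>x y :: 'a. (x + y) ^ Q = x ^ Q + y ^ Q" "\<And>x y :: 'a. (x + y) ^ R = x ^ R + y ^ R"
      "\<And>x y :: 'a. (x + y) ^ S = x ^ S + y ^ S"
    and B: "(B = monom 1 (Q + R) - monom 1 (Q + S) - monom 1 (R + S) - 1
            \<and> cong_pm_mod4 (int Q, int R, int S) (1, 1, 1))
       \<or> (B = monom 1 (R + S) - monom 1 (Q + R) - monom 1 (Q + S) - 1
            \<and> cong_pm_mod4 (int Q, int R, int S) (1, -1, 1))
       \<or> (B = monom 1 (Q + R) + monom 1 (Q + S) + monom 1 (R + S) - 1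
            \<and> cong_pm_mod4 (int Q, int R, int S) (1, 1, -1))"
  shows "- 2 * poly B x = symmetric_split (Q + R) S \<iota> x"
proof -
  obtain s t1 t2 t3 :: int where s: "s \<in> {1, -1}"
    and cong: "[int Q = s * t1] (mod 4)" "[int R = s * t2] (mod 4)" "[int S = s * t3] (mod 4)"
    and t: "(t1, t2, t3) = (1, 1, 1) \<and> B = monom 1 (Q + R) - monom 1 (Q + S) - monom 1 (R + S) - 1
      \<or> (t1, t2, t3) = (1, -1, 1) \<and> B = monom 1 (R + S) - monom 1 (Q + R) - monom 1 (Q + S) - 1
      \<or> (t1, t2, t3) = (1, 1, -1) \<and> B = monom 1 (Q + R) + monom 1 (Q + S) + monom 1 (R + S) - 1"
    using B unfolding cong_pm_mod4_def by fast
  have u: "s * t1 \<in> {1, -1}" "s * t2 \<in> {1, -1}" "s * t3 \<in> {1, -1}" using s t by auto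
  have i2': "\<iota> * (\<iota> * z) = - z" for z using i2 by (simp flip: mult.assoc)
  note exp = power_one_plus_imaginary[OF i2 u(1) cong(1) frob(1)]
    power_one_plus_imaginary[OF i2 u(2) cong(2) frob(2)]
    power_one_plus_imaginary[OF i2 u(3) cong(3) frob(3)]
  from s t show ?thesis
    unfolding symmetric_split_def power_add exp
    by (elim insertE disjE emptyE conjE)
      (simp_all add: poly_monom power_add ring_distribs i2 i2' mult_ac)
qed

lemma cayley_power:
  assumes "1 + \<iota> * y \<noteq> 0" "1 - \<iota> * y \<noteq> 0"
  shows "cayley \<iota> y powi (int A - int S) =
    ((1 + \<iota> * y) ^ A * (1 - \<iota> * y) ^ S) / ((1 - \<iota> * y) ^ A * (1 + \<iota> * y) ^ S)"
proof -
  have "cayley \<iota> y \<noteq> 0" using assms by (simp add: cayley_def)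
  then have "cayley \<iota> y powi (int A - int S) = cayley \<iota> y ^ A / cayley \<iota> y ^ S"
    by (simp only: power_int_diff power_int_of_nat simp_thms)
  then show ?thesis by (simp add: cayley_def power_divide)
qed

text \<open>
  Replacing \<open>y\<close> by \<open>1 / y\<close> exchanges the two summands \<open>U\<close> and \<open>V\<close> of \<open>symmetric_split\<close> up to powers of
  \<open>y\<close> and \<open>\<iota>\<close>; as \<open>A\<close> is even and \<open>S\<close> is odd, the powers of \<open>\<iota>\<close> introduce a relative sign. The quotient
  is therefore \<open>(U - V) / (U + V)\<close> up to a power of \<open>\<iota>\<close>, a fractional linear function of \<open>w = U / V\<close>.
\<close>
lemma power_minus_1_times_quadrinomial:
  fixes b :: "'a::field \<Rightarrow> 'a"
  assumes two: "(2 :: 'a) \<noteq> 0" and i2: "\<iota> * \<iota> = -1"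
    and b: "\<And>x. - 2 * b x = symmetric_split A S \<iota> x"
    and frob: "b y ^ q = b (y ^ q)" and A: "even A" and S: "odd S"
    and q: "q > 0" and y: "y ^ (q + 1) = 1" and r: "[r = A + S] (mod (q + 1))"
    and nz: "1 + \<iota> * y \<noteq> 0" "1 - \<iota> * y \<noteq> 0" "b y \<noteq> 0"
    and w: "w = cayley \<iota> y powi (int A - int S)"
  shows "y ^ r * b y ^ (q - 1) = \<iota> ^ (A + S) * ((w - 1) / (w + 1))"
proof -
  define U V where "U = (1 + \<iota> * y) ^ A * (1 - \<iota> * y) ^ S"
    and "V = (1 - \<iota> * y) ^ A * (1 + \<iota> * y) ^ S"
  have V_nz: "V \<noteq> 0" using nz by (simp add: V_def)
  have y_nz: "y \<noteq> 0" using y by auto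
  have UV: "- 2 * b y = U + V" unfolding b symmetric_split_def U_def V_def ..
  have w': "w = U / V"
    unfolding w U_def V_def by (rule cayley_power[OF nz(1,2)])
  have "U + V \<noteq> 0" using UV nz(3) two by (metis mult_eq_0_iff neg_equal_0_iff_equal)
  then have "w + 1 \<noteq> 0" using V_nz by (simp add: w' field_simps)
  have yq: "y ^ q = 1 / y" using y y_nz by (simp add: field_simps)
  have plus: "y * (1 + \<iota> * (1 / y)) = \<iota> * (1 - \<iota> * y)"
    and minus: "y * (1 - \<iota> * (1 / y)) = - \<iota> * (1 + \<iota> * y)"
    using y_nz i2 by (auto simp: algebra_simps simp flip: mult.assoc)
  have "y ^ (A + S) * (- 2 * b (1 / y)) =
     (y * (1 + \<iota> * (1 / y))) ^ A * (y * (1 - \<iota> * (1 / y))) ^ S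
     + (y * (1 - \<iota> * (1 / y))) ^ A * (y * (1 + \<iota> * (1 / y))) ^ S"
    unfolding b symmetric_split_def power_add power_mult_distrib
    by (simp only: distrib_left mult_ac)
  also have "\<dots> = \<iota> ^ (A + S) * (U - V)"
    unfolding plus minus U_def V_def power_mult_distrib power_add
    using A S by (simp add: power_mult_distrib algebra_simps)
  finally have num: "y ^ (A + S) * (- 2 * b (1 / y)) = \<iota> ^ (A + S) * (U - V)" .
  have yr: "y ^ r = y ^ (A + S)"
  proof -
    have "y ^ n = y ^ (n mod (q + 1))" for n
      using y by (metis mod_div_decomp mult.commute power_add power_mult power_one mult_1)
    then show ?thesis using r by (metis cong_def)
  qed
  have "b y ^ (q - 1) = b (1 / y) / b y"
    using power_minus_mult[OF q, of "b y"] nz(3) frob yq by (simp add: eq_divide_eq)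
  then have "y ^ r * b y ^ (q - 1) = (y ^ (A + S) * (- 2 * b (1 / y))) / (- 2 * b y)"
    using yr two nz(3) by simp
  also have "\<dots> = \<iota> ^ (A + S) * ((U - V) / (U + V))" unfolding num UV by simp
  also have "(U - V) / (U + V) = (w - 1) / (w + 1)"
    using V_nz \<open>U + V \<noteq> 0\<close> by (simp add: w' divide_simps)
  finally show "y ^ r * b y ^ (q - 1) = \<iota> ^ (A + S) * ((w - 1) / (w + 1))" .
qed

lemma frobenius_power:
  fixes x y :: "'a::{field,finite}"
  assumes "prime p" "card (UNIV :: 'a set) = p ^ k" "n = p ^ i"
  shows "(x + y) ^ n = x ^ n + y ^ n"
proof -
  have pr: "prime CHAR('a)" by (intro prime_CHAR_semidom finite_imp_CHAR_pos) simp
  then have "CHAR('a) dvd p"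
    using CHAR_dvd_CARD[where ?'a = 'a] assms(2) prime_dvd_power by metis
  then have "CHAR('a) = p" using pr assms(1) by (simp add: primes_dvd_imp_eq)
  then show ?thesis using freshmans_dream'[OF pr] assms(3) by metis
qed

theorem corollary1p10:
  fixes p k q r Q R S :: nat
    and B f :: "'a::{field,finite} poly"
  assumes "prime p" and "odd p" and "k > 0" and "q = p ^ k"
    and "card (UNIV :: 'a set) = q\<^sup>2"
    and "\<exists>i. Q = p ^ i" and "\<exists>i. R = p ^ i" and "\<exists>i. S = p ^ i"
    and "r > 0" and "[r = Q + R + S] (mod (q + 1))"
    and "f = monom 1 r * pcompose B (monom 1 (q - 1))"
    and "(B = monom 1 (Q + R) - monom 1 (Q + S) - monom 1 (R + S) - 1
            \<and> cong_pm_mod4 (int Q, int R, int S) (1, 1, 1))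
       \<or> (B = monom 1 (R + S) - monom 1 (Q + R) - monom 1 (Q + S) - 1
            \<and> cong_pm_mod4 (int Q, int R, int S) (1, -1, 1))
       \<or> (B = monom 1 (Q + R) + monom 1 (Q + S) + monom 1 (R + S) - 1
            \<and> cong_pm_mod4 (int Q, int R, int S) (1, 1, -1))"
  shows "permutes_field f \<longleftrightarrow>
           [q = 1] (mod 4) \<and> gcd r (q - 1) = 1 \<and> gcd (int Q + int R - int S) (int q + 1) = 1"
proof -
  let ?M = "unity_roots (q + 1) :: 'a set"
  let ?g = "\<lambda>y. y ^ r * poly B y ^ (q - 1)"
  have CARD: "card (UNIV :: 'a set) = p ^ (2 * k)"
    using assms(4,5) by (simp add: power_mult mult.commute)
  note frob = frobenius_power[OF assms(1) CARD]
  obtain iQ iR iS where pow: "Q = p ^ iQ" "R = p ^ iR" "S = p ^ iS"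
    using assms(6-8) by blast
  have frob_q: "(x + y) ^ q = x ^ q + y ^ q" for x y :: 'a
    using frob assms(4) by simp
  have odd: "odd q" "odd Q" "odd R" "odd S" using assms(2,4) pow by auto
  then have q0: "q > 0" by (auto intro: Nat.gr0I)
  have diff_q: "(x - y) ^ q = x ^ q - y ^ q" for x y :: 'a
    using frob_q[of x "-y"] odd(1) by simp
  have N: "card (UNIV :: 'a set) - 1 = (q - 1) * (q + 1)"
    using assms(5) q0 by (simp add: power2_eq_square algebra_simps)
  have two: "(2 :: 'a) \<noteq> 0"
  proof
    assume "(2 :: 'a) = 0"
    then have "of_nat 2 = (0 :: 'a)" by simp
    then have "CHAR('a) dvd 2" using of_nat_eq_0_iff_char_dvd by blast
    moreover have "CHAR('a) dvd p ^ (2 * k)" using CHAR_dvd_CARD[where ?'a = 'a] CARD by simp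
    moreover have "coprime 2 (p ^ (2 * k))" using assms(2) by simp
    ultimately have "CHAR('a) dvd 1" by (metis coprime_common_divisor is_unit_right_imp_coprime)
    then show False by simp
  qed
  obtain \<iota> :: 'a where i2: "\<iota> * \<iota> = -1"
  proof -
    obtain e where e: "q = 2 * e + 1" using odd(1) by (elim oddE)
    \<comment> \<open>The group order is divisible by 4, so \<open>-1\<close> is a square.\<close>
    have "card (UNIV :: 'a set) - 1 = 2 * (2 * (e * (e + 1)))"
      unfolding N e by (simp add: algebra_simps)
    from power_image_eq_unity_roots[OF this]
    have "-1 \<in> (\<lambda>x :: 'a. x ^ 2) ` (UNIV - {0})" by (simp add: power_mult)
    then obtain x :: 'a where "x ^ 2 = -1" by (metis imageE)
    then show ?thesis by (intro that[of x]) (simp add: power2_eq_square)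
  qed
  have split: "- 2 * poly B x = symmetric_split (Q + R) S \<iota> x" for x
    by (rule quadrinomial_eq_symmetric_split[OF i2 _ _ _ assms(12)]) (use frob pow in auto)
  \<comment> \<open>\<open>B\<close> has coefficients in the prime field.\<close>
  have conj: "poly B y ^ q = poly B (y ^ q)" for y
    using assms(12)
    by (elim disjE conjE) (auto simp: poly_monom frob_q diff_q mult.commute simp flip: power_mult)
  have "poly f = (\<lambda>x. x ^ r * poly B (x ^ (q - 1)))"
    using assms(11) by (simp add: fun_eq_iff poly_pcompose poly_monom)
  then have crit: "permutes_field f \<longleftrightarrow> coprime r (q - 1) \<and> bij_betw ?g ?M ?M"
    unfolding permutes_field_def using bij_power_times_iff[OF N assms(9)] by simp
  show ?thesis
  proof (cases "[q = 1] (mod 4)")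
    case True
    have iq: "\<iota> ^ q = \<iota>"
      using power_imaginary_unit[OF i2, of 1 q] True cong_int_iff[of q 1 4] by simp
    let ?T = "{z :: 'a. z ^ (q + 1) = -1}" and ?n = "int (Q + R) - int S"
    let ?psi = "\<lambda>w. \<iota> ^ (Q + R + S) * ((w - 1) / (w + 1))"
    have iq1: "\<iota> ^ (q + 1) = -1" using iq i2 by simp
    note nz = cayley_denominators_nonzero[OF two odd(1) iq1]
    have T: "bij_betw (cayley \<iota>) ?M ?T"
      by (rule bij_betw_cayley[OF two odd(1) i2 iq frob_q])
    \<comment> \<open>\<open>-1\<close> is not an \<open>?n\<close>-th power of an element of \<open>?T\<close>: as \<open>?n\<close> is odd, such a power
      again has \<open>(q + 1)\<close>-th power \<open>-1\<close>, but \<open>-1\<close> does not. So \<open>B\<close> has no zero on \<open>?M\<close>.\<close>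
    have w_nz: "z powi ?n + 1 \<noteq> 0" if "z \<in> ?T" for z
    proof
      assume "z powi ?n + 1 = 0"
      then have "z powi ?n = -1" by (simp add: add_eq_0_iff2)
      then have "(z powi ?n) ^ (q + 1) = 1" using odd(1) by simp
      moreover have "(z powi ?n) ^ (q + 1) = (z ^ (q + 1)) powi ?n"
        by (metis mult.commute power_int_mult power_int_of_nat)
      moreover have "odd ?n" using odd by simp
      ultimately have "(-1 :: 'a) = 1" using that by (simp add: power_int_minus_left)
      then show False using two by (metis add_eq_0_iff one_add_one)
    qed
    have B_nz: "poly B y \<noteq> 0" if "y \<in> ?M" for y
    proof
      assume "poly B y = 0"
      then have "symmetric_split (Q + R) S \<iota> y = 0" using split[of y] by simp
      moreover have y: "1 + \<iota> * y \<noteq> 0" "1 - \<iota> * y \<noteq> 0" using nz that by auto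
      ultimately have "cayley \<iota> y powi ?n + 1 = 0"
        unfolding symmetric_split_def cayley_power[OF y] by (simp add: field_simps)
      then show False using w_nz T that by (meson bij_betwE)
    qed
    have g: "?g y = (?psi \<circ> (\<lambda>z. z powi ?n) \<circ> cayley \<iota>) y" if "y \<in> ?M" for y
      unfolding o_def
      by (rule power_minus_1_times_quadrinomial[OF two i2 split conj _ odd(4) q0 _ assms(10) _ _ _ refl])
        (use that nz B_nz odd in auto)
    have psi: "inj_on ?psi ((\<lambda>z. z powi ?n) ` ?T)"
    proof (rule inj_onI)
      fix w w' assume "w \<in> (\<lambda>z. z powi ?n) ` ?T" "w' \<in> (\<lambda>z. z powi ?n) ` ?T"
        and eq: "?psi w = ?psi w'"
      then have ne: "w + 1 \<noteq> 0" "w' + 1 \<noteq> 0" using w_nz by auto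
      have "\<iota> \<noteq> 0" using i2 by auto
      then have "(w - 1) / (w + 1) = (w' - 1) / (w' + 1)"
        using eq by (metis mult_cancel_left power_not_zero)
      then have "2 * w = 2 * w'" using ne by (simp add: field_simps)
      then show "w = w'" using two by simp
    qed
    have into: "?g ` ?M \<subseteq> ?M"
    proof safe
      fix y :: 'a assume y: "y ^ (q + 1) = 1"
      have "(y ^ r) ^ (q + 1) = 1" using y by (metis mult.commute power_mult power_one)
      moreover have "(poly B y ^ (q - 1)) ^ (q + 1) = 1"
        using power_card_minus_1[of "poly B y"] B_nz y N by (simp only: power_mult) simp
      ultimately show "?g y ^ (q + 1) = 1" by (simp only: power_mult_distrib) simp
    qed
    have m_dvd: "q + 1 dvd card (UNIV :: 'a set) - 1" unfolding N by (rule dvd_triv_right)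
    obtain z0 :: 'a where z0: "z0 ^ (q + 1) = -1"
      using T by (metis (mono_tags, lifting) bij_betwE mem_Collect_eq power_one)
    have "bij_betw ?g ?M ?M \<longleftrightarrow> inj_on ?g ?M"
      using endo_inj_surj[OF _ into] by (auto simp: bij_betw_def)
    also have "\<dots> \<longleftrightarrow> inj_on (?psi \<circ> (\<lambda>z. z powi ?n) \<circ> cayley \<iota>) ?M"
      by (rule inj_on_cong) (rule g)
    also have "\<dots> \<longleftrightarrow> inj_on (?psi \<circ> (\<lambda>z. z powi ?n)) ?T"
      by (rule comp_inj_on_iff[OF bij_betw_imp_inj_on[OF T],
          unfolded bij_betw_imp_surj_on[OF T], symmetric])
    also have "\<dots> \<longleftrightarrow> inj_on (\<lambda>z. z powi ?n) ?T"
      by (rule iffI, erule inj_on_imageI2, erule comp_inj_on, rule psi)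
    also have "\<dots> \<longleftrightarrow> coprime ?n (int (q + 1))"
      by (rule inj_on_power_int_coset_iff[OF m_dvd z0]) simp
    finally show ?thesis
      using crit True
      by (simp only: coprime_iff_gcd_eq_1 of_nat_add of_nat_1 simp_thms)
  next
    case False
    then have "q mod 4 = 3" using odd(1) by (simp add: cong_def) presburger
    then have "[int q = -1] (mod 4)" by (simp add: cong_def) presburger
    then have "\<iota> ^ q = - \<iota>" using power_imaginary_unit[OF i2, of "-1" q] by simp
    then have i_M: "\<iota> \<in> ?M" using i2 by simp
    \<comment> \<open>Both summands have a positive power of \<open>1 + \<iota> * \<iota> = 0\<close> as a factor.\<close>
    have "Q + R > 0" "S > 0" using odd by (auto intro: Nat.gr0I)
    then have zero: "(0 :: 'a) ^ (Q + R) = 0" "(0 :: 'a) ^ S = 0" by (simp_all only: zero_power)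
    have "- 2 * poly B \<iota> = 0"
      unfolding split symmetric_split_def i2
      by (simp only: add.right_inverse zero mult_zero_left mult_zero_right add_0)
    then have "poly B \<iota> = 0" using two by simp
    moreover have "q - 1 > 0"
      using N card_minus_1_pos[where ?'a = 'a] by (auto intro: Nat.gr0I)
    ultimately have "?g \<iota> = 0" by simp
    then have "\<not> bij_betw ?g ?M ?M"
      using i_M
      by (metis (mono_tags, lifting) bij_betwE mem_Collect_eq power_0_left
          Suc_eq_plus1 nat.distinct(1) zero_neq_one)
    then show ?thesis using crit False by simp
  qed
qed

end
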